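(* Let $G$ be an $n \times n$ bipartite graph (with $n \geq 1$) and let $d \geq 0$ be an integer. Then \[ \beta_d(G) \geq \left\lfloor \frac{1}{2} \cdot \sum_{v \in V(G)} \min\left(1, \frac{d+1}{d(v)+1}\right) \right\rfloor, \] where $d(v)$ denotes the degree of $v$ in $G$.
   Context: An $n \times n$ bipartite graph is a bipartite graph $G=(A,B,E)$ with a fixed bipartition into parts $A$ and $B$ satisfying $|A|=|B|=n$. A graph $H$ is $d$-degenerate if every non-empty subgraph of $H$ contains a vertex of degree at most $d$. $\beta_d(G)$ denotes the largest $k$ for which there exist $X \subseteq A$ and $Y \subseteq B$ with $|X|=|Y|=k$ such that the subgraph of $G$ induced by $X \cup Y$ is $d$-degenerate (a $k \times k$ induced $d$-degenerate subgraph). *)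

theory Defs
  imports Complex_Main "Graph_Theory.Graph_Theory"
begin

text \<open>
  A finite simple undirected graph is, as everywhere in \<open>Graph_Theory\<close>, a symmetric loop-free
  digraph without parallel arcs (locale \<open>graph\<close>): an edge \<open>uv\<close> is the pair of arcs \<open>u \<rightarrow> v\<close>,
  \<open>v \<rightarrow> u\<close>. Each edge at \<open>v\<close> contributes exactly one arc with tail \<open>v\<close>, so the undirected
  degree is the out-degree.
\<close>

abbreviation degree :: "('a, 'b) pre_digraph \<Rightarrow> 'a \<Rightarrow> nat" where
  "degree G v \<equiv> out_degree G v"

definition bipartite_graph ::
  "nat \<Rightarrow> ('a, 'b) pre_digraph \<Rightarrow> 'a set \<Rightarrow> 'a set \<Rightarrow> bool" where
  "bipartite_graph n G A B \<longleftrightarrow>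
     graph G \<and> verts G = A \<union> B \<and> A \<inter> B = {} \<and> card A = n \<and> card B = n \<and>
     (\<forall>e \<in> arcs G. (tail G e \<in> A \<and> head G e \<in> B) \<or> (tail G e \<in> B \<and> head G e \<in> A))"

text \<open>
  The library's \<open>subgraph\<close> also admits non-symmetric sub-digraphs; \<open>graph H\<close> restricts the
  quantifier to undirected subgraphs.
\<close>

definition degenerate :: "nat \<Rightarrow> ('a, 'b) pre_digraph \<Rightarrow> bool" where
  "degenerate d G \<longleftrightarrow>
     (\<forall>H. graph H \<and> subgraph H G \<and> verts H \<noteq> {} \<longrightarrow> (\<exists>v \<in> verts H. degree H v \<le> d))"

text \<open>
  For a bipartite graph with finite parts the set below contains \<open>0\<close> and is bounded by
  \<open>card A\<close>, so the maximum is attained.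
\<close>

definition beta :: "nat \<Rightarrow> ('a, 'b) pre_digraph \<Rightarrow> 'a set \<Rightarrow> 'a set \<Rightarrow> nat" where
  "beta d G A B =
     Max {k. \<exists>X Y. X \<subseteq> A \<and> Y \<subseteq> B \<and> card X = k \<and> card Y = k \<and> degenerate d (G \<restriction> (X \<union> Y))}"

end

theory Submission
  imports Defs
begin

text \<open>
  The weight \<open>S\<close> of a graph is the sum of \<open>w (d(v)) = min 1 ((d + 1) / (d(v) + 1))\<close> over its
  vertices. Vertices outside the \<open>d\<close>-core (the largest induced subgraph of minimum degree above \<open>d\<close>)
  can be kept for free, and keeping them costs no weight, so only the core matters. From a core with
  maximum degrees \<open>p\<close> on \<open>A\<close> and \<open>q\<close> on \<open>B\<close>, delete a vertex \<open>a\<close> of degree \<open>p\<close> and a vertex \<open>b\<close> of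
  degree \<open>q\<close>, non-adjacent if possible, and pass to the core again. Each step deletes one vertex on
  each side. If \<open>a\<close> and \<open>b\<close> are not adjacent, the weight does not drop, because
  \<open>p/(q(q+1)) + q/(p(p+1)) \<ge> 1/(p+1) + 1/(q+1)\<close>. If they have to be adjacent, then all vertices
  of maximum degree are adjacent, so both maxima drop, and the lost weight is at most the increase of
  \<open>w p + w q\<close>. Hence \<open>S + w p + w q - 1\<close> is a lower bound for the final number of kept vertices;
  at the last step, where the core vanishes, one deletion may be saved, which leaves the two sides
  unbalanced by at most one. Thus more than \<open>S - 1\<close> vertices are kept, almost equally many on each
  side, and by integrality each side keeps at least \<open>\<lfloor>S / 2\<rfloor>\<close>.
\<close>

section \<open>Bipartite adjacency on vertex sets\<close>

locale bipartite_adjacency =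
  fixes A B :: "'a set" and adj :: "'a \<Rightarrow> 'a \<Rightarrow> bool" and d :: nat
  assumes finite_A: "finite A" and finite_B: "finite B" and disjoint: "A \<inter> B = {}"
    and adj_sym: "adj u v \<Longrightarrow> adj v u"
    and adj_sides: "adj u v \<Longrightarrow> (u \<in> A \<and> v \<in> B) \<or> (u \<in> B \<and> v \<in> A)"
begin

definition nbs :: "'a set \<Rightarrow> 'a \<Rightarrow> 'a set" where
  "nbs W v = {u \<in> W. adj v u}"

definition deg :: "'a set \<Rightarrow> 'a \<Rightarrow> nat" where
  "deg W v = card (nbs W v)"

definition w :: "nat \<Rightarrow> real" where
  "w k = min 1 ((real d + 1) / (real k + 1))"

definition S :: "'a set \<Rightarrow> real" where
  "S W = (\<Sum>v\<in>W. w (deg W v))"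

definition dense :: "'a set \<Rightarrow> bool" where
  "dense W \<longleftrightarrow> (\<forall>v\<in>W. d < deg W v)"

text \<open>What remains after repeatedly removing vertices of degree at most \<open>d\<close>; as a
  union of \<open>dense\<close> sets it needs no order of removal.\<close>

definition core :: "'a set \<Rightarrow> 'a set" where
  "core U = \<Union> {H. H \<subseteq> U \<and> dense H}"

text \<open>Only induced subgraphs are tested. This suffices for \<open>degenerate\<close>, since
  dropping edges only lowers degrees.\<close>

definition degen :: "'a set \<Rightarrow> bool" where
  "degen K \<longleftrightarrow> (\<forall>H. H \<subseteq> K \<and> dense H \<longrightarrow> H = {})"

section \<open>Degrees and weights\<close>

lemma finite_sub: "W \<subseteq> A \<union> B \<Longrightarrow> finite W"
  using finite_A finite_B finite_subset by blast

lemma finite_nbs: "finite (nbs W v)"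
  by (rule finite_sub) (auto simp: nbs_def dest: adj_sides)

lemma deg_mono: "W \<subseteq> W' \<Longrightarrow> deg W v \<le> deg W' v"
  unfolding deg_def by (rule card_mono[OF finite_nbs]) (auto simp: nbs_def)

lemma deg_delete:
  assumes "x \<in> W"
  shows "deg (W - {x}) v = deg W v - (if adj v x then 1 else 0)"
proof -
  have "nbs (W - {x}) v = nbs W v - {x}" by (auto simp: nbs_def)
  then show ?thesis using assms finite_nbs[of W v] by (auto simp: deg_def nbs_def)
qed

lemma w_le_1: "w k \<le> 1"
  by (simp add: w_def)

lemma w_pos: "0 < w k"
  by (simp add: w_def)

lemma w_antimono: "k \<le> l \<Longrightarrow> w l \<le> w k"
  unfolding w_def by (intro min.mono order.refl divide_left_mono) auto

lemma w_eq: "d \<le> k \<Longrightarrow> w k = (real d + 1) / (real k + 1)"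
  by (simp add: w_def min_absorb2 divide_le_eq_1)

text \<open>A vertex of degree \<open>k\<close> above \<open>d\<close> that loses a neighbour gains
  exactly \<open>(d + 1) / (k * (k + 1))\<close>, which decreases in \<open>k\<close>; hence an
  upper bound \<open>m\<close> on the degree gives a lower bound on the gain.\<close>

lemma w_gain:
  assumes "d < k" "k \<le> m"
  shows "w k + (real d + 1) / (real m * (real m + 1)) \<le> w (k - 1)"
proof -
  have k: "0 < real k" using assms by simp
  have "(real d + 1) / (real m * (real m + 1)) \<le> (real d + 1) / (real k * (real k + 1))"
    using assms k by (intro divide_left_mono mult_mono mult_pos_pos) auto
  also have "\<dots> = (real d + 1) / real k - (real d + 1) / (real k + 1)"
    using k by (simp add: field_simps)
  also have "\<dots> = w (k - 1) - w k"
    using assms by (simp add: w_eq of_nat_diff)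
  finally show ?thesis by simp
qed

section \<open>Cores and degenerate sets\<close>

lemma dense_core: "dense (core U)"
  unfolding dense_def
proof
  fix v assume "v \<in> core U"
  then obtain H where H: "v \<in> H" "H \<subseteq> U" "dense H" by (auto simp: core_def)
  then have "H \<subseteq> core U" by (auto simp: core_def)
  then show "d < deg (core U) v"
    using H deg_mono[of H "core U" v] by (fastforce simp: dense_def)
qed

lemma core_subset: "core U \<subseteq> U"
  by (auto simp: core_def)

lemma subset_core: "H \<subseteq> U \<Longrightarrow> dense H \<Longrightarrow> H \<subseteq> core U"
  by (auto simp: core_def)

text \<open>The peeled vertices come back for free: a \<open>dense\<close> subset of the union lies
  in \<open>core U\<close>, hence already in \<open>K\<close>.\<close>

lemma degen_extend:
  assumes "degen K" "K \<subseteq> core U"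
  shows "degen (K \<union> (U - core U))"
  unfolding degen_def
proof (intro allI impI)
  fix H assume H: "H \<subseteq> K \<union> (U - core U) \<and> dense H"
  then have "H \<subseteq> core U"
    using assms core_subset[of U] by (intro subset_core) auto
  with H have "H \<subseteq> K" by auto
  with H assms show "H = {}" by (auto simp: degen_def)
qed

lemma degen_empty: "degen {}"
  by (auto simp: degen_def)

lemma degen_subset: "degen K \<Longrightarrow> L \<subseteq> K \<Longrightarrow> degen L"
  by (auto simp: degen_def)

lemma degen_core_empty: "core U = {} \<Longrightarrow> degen U"
  using degen_extend[OF degen_empty, of U] by simp

text \<open>A peeled vertex carries weight at most 1, the amount by which keeping it raises the
  count, and degrees inside the core only drop.\<close>

lemma S_le_core:
  assumes "U \<subseteq> A \<union> B"
  shows "S U \<le> real (card (U - core U)) + S (core U)"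
proof -
  have fin: "finite U" using assms by (rule finite_sub)
  have "S U = (\<Sum>v\<in>U - core U. w (deg U v)) + (\<Sum>v\<in>core U. w (deg U v))"
    unfolding S_def using sum.subset_diff[OF core_subset fin] .
  also have "\<dots> \<le> (\<Sum>v\<in>U - core U. 1) + S (core U)"
    unfolding S_def
    by (intro add_mono sum_mono w_le_1 w_antimono deg_mono core_subset)
  finally show ?thesis by simp
qed

section \<open>Change of weight under deletion\<close>

lemma sum_adj:
  "(\<Sum>v\<in>W. if adj v x then c else 0) = real (deg W x) * c" if "W \<subseteq> A \<union> B"
proof -
  have "(\<Sum>v\<in>W. if adj v x then c else 0) = (\<Sum>v\<in>nbs W x. c)"
    using finite_sub[OF that] adj_sym by (intro sum.mono_neutral_cong_right) (auto simp: nbs_def)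
  then show ?thesis by (simp add: deg_def)
qed

lemma not_adj_self: "\<not> adj v v"
  using adj_sides[of v v] disjoint by auto

text \<open>With \<open>P\<close> the degree of \<open>x\<close>, the lost weight \<open>w P\<close>
  equals \<open>P * c\<close>, and each of the \<open>P\<close> neighbours gains at least
  \<open>c\<close> because its degree is at most \<open>P\<close>.\<close>

lemma S_delete_max:
  assumes R: "R \<subseteq> A \<union> B" "dense R" and x: "x \<in> R"
    and le: "\<And>v. v \<in> R \<Longrightarrow> adj v x \<Longrightarrow> deg R v \<le> deg R x"
  shows "S R \<le> S (R - {x})"
proof -
  define P where "P = deg R x"
  define c where "c = (real d + 1) / (real P * (real P + 1))"
  have dP: "d < P" using R x by (auto simp: dense_def P_def)
  have fin: "finite R" using R finite_sub by blast
  have "S R = w P + (\<Sum>v\<in>R - {x}. w (deg R v))"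
    unfolding S_def P_def using fin x by (rule sum.remove)
  also have "w P = real (deg (R - {x}) x) * c"
    using dP x by (simp add: deg_delete not_adj_self w_eq c_def P_def[symmetric])
  also have "\<dots> = (\<Sum>v\<in>R - {x}. if adj v x then c else 0)"
    using R by (intro sum_adj[symmetric]) auto
  also have "\<dots> + (\<Sum>v\<in>R - {x}. w (deg R v)) =
      (\<Sum>v\<in>R - {x}. w (deg R v) + (if adj v x then c else 0))"
    by (simp add: sum.distrib)
  also have "\<dots> \<le> S (R - {x})"
    unfolding S_def
  proof (rule sum_mono)
    fix v assume v: "v \<in> R - {x}"
    show "w (deg R v) + (if adj v x then c else 0) \<le> w (deg (R - {x}) v)"
      using v x R le[of v] w_gain[of "deg R v" P]
      by (auto simp: deg_delete c_def P_def dense_def)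
  qed
  finally show ?thesis .
qed

text \<open>The \<open>p\<close> neighbours of \<open>a\<close> lie in \<open>B\<close>, so their
  gains are bounded through \<open>q\<close>, and symmetrically for \<open>b\<close>. The correction
  \<open>\<epsilon>\<close> discounts \<open>a\<close> and \<open>b\<close> as each other's
  neighbour, since neither survives.\<close>

lemma S_delete_pair:
  assumes R: "R \<subseteq> A \<union> B" "dense R" and a: "a \<in> R \<inter> A" and b: "b \<in> R \<inter> B"
    and leA: "\<And>v. v \<in> R \<inter> A \<Longrightarrow> deg R v \<le> deg R a"
    and leB: "\<And>v. v \<in> R \<inter> B \<Longrightarrow> deg R v \<le> deg R b"
    and p: "p = deg R a" and q: "q = deg R b" and \<epsilon>: "\<epsilon> = (if adj a b then 1 else 0)"
  shows "S R - w p - w q + (real p - \<epsilon>) * ((real d + 1) / (real q * (real q + 1)))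
       + (real q - \<epsilon>) * ((real d + 1) / (real p * (real p + 1))) \<le> S (R - {a, b})"
proof -
  define ca where "ca = (real d + 1) / (real q * (real q + 1))"
  define cb where "cb = (real d + 1) / (real p * (real p + 1))"
  define U where "U = R - {a} - {b}"
  have U: "R - {a, b} = U" by (auto simp: U_def)
  have ab: "a \<noteq> b" using a b disjoint by auto
  have dp: "d < p" "d < q" using R a b by (auto simp: dense_def p q)
  have fin: "finite R" using R finite_sub by blast
  have subU: "U \<subseteq> A \<union> B" using R by (auto simp: U_def)
  have degU: "deg U v = deg R v - (if adj v a then 1 else 0) - (if adj v b then 1 else 0)" for v
    using a b ab by (simp add: U_def deg_delete)
  have sym: "adj b a \<longleftrightarrow> adj a b" using adj_sym by blast
  have "S R = w p + (w q + (\<Sum>v\<in>U. w (deg R v)))"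
    unfolding S_def U_def p q
    using fin a b ab by (simp add: sum.remove[of R a] sum.remove[of "R - {a}" b])
  moreover have "real p - \<epsilon> = real (deg U a)" "real q - \<epsilon> = real (deg U b)"
    using dp by (auto simp: degU not_adj_self p q \<epsilon> sym)
  moreover have "(\<Sum>v\<in>U. w (deg R v)) + real (deg U a) * ca + real (deg U b) * cb =
      (\<Sum>v\<in>U. w (deg R v) + (if adj v a then ca else 0) + (if adj v b then cb else 0))"
    using subU by (simp add: sum.distrib sum_adj)
  moreover have "\<dots> \<le> S U"
    unfolding S_def
  proof (rule sum_mono)
    fix v assume v: "v \<in> U"
    then have vR: "v \<in> R" by (simp add: U_def)
    then have dv: "d < deg R v" using R by (auto simp: dense_def)
    \<comment> \<open>By bipartiteness no vertex sees both \<open>a\<close> and \<open>b\<close>, so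
      each survivor loses at most one neighbour.\<close>
    consider "adj v a" "\<not> adj v b" "v \<in> R \<inter> B" | "adj v b" "\<not> adj v a" "v \<in> R \<inter> A"
      | "\<not> adj v a" "\<not> adj v b"
      using adj_sides[of v a] adj_sides[of v b] a b disjoint vR by auto
    then show "w (deg R v) + (if adj v a then ca else 0) + (if adj v b then cb else 0)
        \<le> w (deg U v)"
    proof cases
      case 1
      then show ?thesis using w_gain[OF dv leB] by (simp add: degU ca_def q)
    next
      case 2
      then show ?thesis using w_gain[OF dv leA] by (simp add: degU cb_def p)
    next
      case 3
      then show ?thesis by (simp add: degU)
    qed
  qed
  ultimately show ?thesis unfolding U ca_def[symmetric] cb_def[symmetric] by simp
qed

section \<open>Size of dense sets\<close>

lemma dense_sides:
  assumes "R \<subseteq> A \<union> B" "dense R" "R \<noteq> {}"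
  shows "d < card (R \<inter> A)" "d < card (R \<inter> B)"
proof -
  have opp: "(v \<in> A \<longrightarrow> d < card (R \<inter> B)) \<and> (v \<in> B \<longrightarrow> d < card (R \<inter> A))" if "v \<in> R" for v
  proof -
    have "v \<in> A \<Longrightarrow> nbs R v \<subseteq> R \<inter> B" "v \<in> B \<Longrightarrow> nbs R v \<subseteq> R \<inter> A"
      using adj_sides[of v] disjoint by (auto simp: nbs_def)
    then have "v \<in> A \<Longrightarrow> deg R v \<le> card (R \<inter> B)" "v \<in> B \<Longrightarrow> deg R v \<le> card (R \<inter> A)"
      unfolding deg_def using finite_A finite_B by (auto intro!: card_mono)
    then show ?thesis using assms(2) that by (force simp: dense_def)
  qed
  have nonempty: "X \<noteq> {}" if "d < card X" for X :: "'a set" using that by auto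
  from assms obtain v where v: "v \<in> R" "v \<in> A \<or> v \<in> B" by auto
  from v(2) have "d < card (R \<inter> A) \<and> d < card (R \<inter> B)"
  proof
    assume "v \<in> A"
    then have "d < card (R \<inter> B)" using opp v by blast
    moreover from nonempty[OF this] have "d < card (R \<inter> A)" using opp by blast
    ultimately show ?thesis by blast
  next
    assume "v \<in> B"
    then have "d < card (R \<inter> A)" using opp v by blast
    moreover from nonempty[OF this] have "d < card (R \<inter> B)" using opp by blast
    ultimately show ?thesis by blast
  qed
  then show "d < card (R \<inter> A)" "d < card (R \<inter> B)" by auto
qed

lemma card_sides:
  assumes "R \<subseteq> A \<union> B"
  shows "card R = card (R \<inter> A) + card (R \<inter> B)"
proof -
  have "card ((R \<inter> A) \<union> (R \<inter> B)) = card (R \<inter> A) + card (R \<inter> B)"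
    using finite_A finite_B disjoint by (intro card_Un_disjoint) auto
  moreover have "(R \<inter> A) \<union> (R \<inter> B) = R" using assms by auto
  ultimately show ?thesis by simp
qed

text \<open>Every weight is at most \<open>t = (d + 1) / (d + 2)\<close>, so the deficit
  \<open>card R - S R\<close> is at least \<open>card R / (d + 2)\<close>. Both sides have at least
  \<open>d + 1\<close> vertices, which makes this at least \<open>2 * t\<close>.\<close>

lemma S_dense_le:
  assumes R: "R \<subseteq> A \<union> B" "dense R" "R \<noteq> {}" and pq: "d < p" "d < q"
  shows "S R + w p + w q \<le> real (card R)"
proof -
  define t where "t = w (Suc d)"
  have t: "t = (real d + 1) / (real d + 2)" by (simp add: t_def w_eq add.commute)
  have "S R \<le> (\<Sum>v\<in>R. t)"
    unfolding S_def t_def using R by (intro sum_mono w_antimono) (auto simp: dense_def Suc_le_eq)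
  then have SR: "S R \<le> real (card R) * t" by simp
  have wp: "w p \<le> t" "w q \<le> t" unfolding t_def using pq by (auto intro!: w_antimono)
  have "2 * (real d + 1) \<le> real (card R)"
  proof -
    have "2 * (d + 1) \<le> card R" using dense_sides[OF R] card_sides[OF R(1)] by presburger
    then have "real (2 * (d + 1)) \<le> real (card R)" by (simp only: of_nat_le_iff)
    then show ?thesis by simp
  qed
  then have "2 * (real d + 1) / (real d + 2) \<le> real (card R) / (real d + 2)"
    by (intro divide_right_mono) auto
  moreover have "real (card R) - real (card R) * t = real (card R) / (real d + 2)"
    by (simp add: t field_simps)
  moreover have "2 * t = 2 * (real d + 1) / (real d + 2)" by (simp add: t)
  ultimately show ?thesis using SR wp by linarith
qed

section \<open>Deleting one vertex of maximum degree on each side\<close>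

lemma cross_ratio_ineq:
  fixes p q :: real
  assumes "p > 0" "q > 0"
  shows "1 / (p + 1) + 1 / (q + 1) \<le> p / (q * (q + 1)) + q / (p * (p + 1))"
proof -
  have "p / (q * (q + 1)) + q / (p * (p + 1)) - (1 / (p + 1) + 1 / (q + 1))
      = (p - q)\<^sup>2 * (p + q + 1) / (p * q * (p + 1) * (q + 1))"
    using assms by (simp add: divide_simps add_pos_pos) (simp add: algebra_simps power2_eq_square)
  moreover have "\<dots> \<ge> 0" using assms by simp
  ultimately show ?thesis by linarith
qed

lemma S_delete_nonadjacent:
  assumes R: "R \<subseteq> A \<union> B" "dense R" and a: "a \<in> R \<inter> A" and b: "b \<in> R \<inter> B"
    and leA: "\<And>v. v \<in> R \<inter> A \<Longrightarrow> deg R v \<le> deg R a"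
    and leB: "\<And>v. v \<in> R \<inter> B \<Longrightarrow> deg R v \<le> deg R b"
    and nadj: "\<not> adj a b"
  shows "S R \<le> S (R - {a, b})"
proof -
  define p q where "p = real (deg R a)" and "q = real (deg R b)"
  have dp: "d < deg R a" "d < deg R b" using R a b by (auto simp: dense_def)
  have "(real d + 1) * (1 / (p + 1) + 1 / (q + 1))
      \<le> (real d + 1) * (p / (q * (q + 1)) + q / (p * (p + 1)))"
    using dp by (intro mult_left_mono cross_ratio_ineq) (auto simp: p_def q_def)
  then show ?thesis
    using S_delete_pair[OF R a b leA leB refl refl refl] dp nadj
    by (simp add: w_eq p_def q_def algebra_simps)
qed

lemma S_delete_adjacent:
  assumes R: "R \<subseteq> A \<union> B" "dense R" and a: "a \<in> R \<inter> A" and b: "b \<in> R \<inter> B"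
    and leA: "\<And>v. v \<in> R \<inter> A \<Longrightarrow> deg R v \<le> deg R a"
    and leB: "\<And>v. v \<in> R \<inter> B \<Longrightarrow> deg R v \<le> deg R b"
    and ab: "adj a b"
  shows "S R + w (deg R a) + w (deg R b) \<le> S (R - {a, b}) + w (deg R a - 1) + w (deg R b - 1)"
proof -
  define p q where "p = real (deg R a)" and "q = real (deg R b)"
  define e where "e = real d + 1"
  have dp: "d < deg R a" "d < deg R b" using R a b by (auto simp: dense_def)
  have pos: "p > 0" "q > 0" using dp by (auto simp: p_def q_def)
  have W: "w (deg R a) = e / (p + 1)" "w (deg R b) = e / (q + 1)"
    "w (deg R a - 1) = e / p" "w (deg R b - 1) = e / q"
    using dp by (simp_all add: w_eq p_def q_def e_def of_nat_diff)
  have "e * (1 / (p + 1) + 1 / (q + 1)) \<le> e * (p / (q * (q + 1)) + q / (p * (p + 1)))"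
    using pos by (intro mult_left_mono cross_ratio_ineq) (auto simp: e_def)
  \<comment> \<open>The gain missing because of the edge \<open>ab\<close> is exactly the increment
    \<open>e / q - e / (q + 1)\<close>, and likewise with \<open>p\<close>; this reduces to the
    non-adjacent computation.\<close>
  moreover have "(p - 1) * (e / (q * (q + 1))) + e / q = e * (p / (q * (q + 1))) + e / (q + 1)"
    "(q - 1) * (e / (p * (p + 1))) + e / p = e * (q / (p * (p + 1))) + e / (p + 1)"
    using pos by (simp_all add: divide_simps) (simp_all add: algebra_simps)
  moreover have "S R - e / (p + 1) - e / (q + 1) + (p - 1) * (e / (q * (q + 1)))
      + (q - 1) * (e / (p * (p + 1))) \<le> S (R - {a, b})"
    using S_delete_pair[OF R a b leA leB refl refl refl] ab
    by (simp add: W p_def[symmetric] q_def[symmetric] e_def[symmetric])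
  ultimately show ?thesis unfolding W by (simp add: algebra_simps)
qed

section \<open>Balanced deletion until the core vanishes\<close>

text \<open>If deleting \<open>x\<close> alone empties the core, \<open>y\<close> is kept and
  \<open>S_dense_le\<close> for \<open>R\<close> suffices. Otherwise \<open>S_dense_le\<close>
  applies to the surviving core, and the spare \<open>w p + w q\<close> it yields lets
  \<open>y\<close> go at the cost of 1.\<close>

lemma degen_of_vanishing_core:
  assumes R: "R \<subseteq> A \<union> B" "dense R" "R \<noteq> {}" and xy: "x \<in> R" "y \<in> R" "x \<noteq> y"
    and le: "\<And>v. v \<in> R \<Longrightarrow> adj v x \<Longrightarrow> deg R v \<le> deg R x"
    and pq: "d < p" "d < q" and empty: "core (R - {x, y}) = {}"
  shows "\<exists>K. (K = R - {x} \<or> K = R - {x, y}) \<and> degen K \<and> S R + w p + w q - 1 \<le> real (card K)"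
proof (cases "core (R - {x}) = {}")
  case True
  have "S R + w p + w q - 1 \<le> real (card (R - {x}))"
    using S_dense_le[OF R pq] xy(1) finite_sub[OF R(1)] by (simp add: card_Diff_singleton)
  then show ?thesis using degen_core_empty[OF True] by blast
next
  case False
  let ?C = "core (R - {x})"
  have fin: "finite R" by (rule finite_sub[OF R(1)])
  have sub: "?C \<subseteq> R - {x}" by (rule core_subset)
  have "S R \<le> S (R - {x})" using S_delete_max[OF R(1,2) xy(1) le] .
  also have "\<dots> \<le> real (card (R - {x} - ?C)) + S ?C" using R by (intro S_le_core) auto
  also have "S ?C \<le> real (card ?C) - w p - w q"
    using S_dense_le[OF _ dense_core False pq] sub R by force
  finally have "S R + w p + w q \<le> real (card (R - {x} - ?C) + card ?C)" by simp
  also have "card (R - {x} - ?C) + card ?C = card (R - {x})"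
    using sub fin by (metis card_Diff_subset card_mono finite_Diff finite_subset le_add_diff_inverse2)
  also have "card (R - {x}) = Suc (card (R - {x, y}))"
  proof -
    have "R - {x} - {y} = R - {x, y}" by auto
    then show ?thesis using xy fin card.remove[of "R - {x}" y] by simp
  qed
  finally have "S R + w p + w q - 1 \<le> real (card (R - {x, y}))" by simp
  then show ?thesis using degen_core_empty[OF empty] by blast
qed

lemma exists_max_pair:
  assumes R: "R \<subseteq> A \<union> B" "dense R" "R \<noteq> {}"
  obtains a b where "a \<in> R \<inter> A" "b \<in> R \<inter> B"
    "\<And>v. v \<in> R \<inter> A \<Longrightarrow> deg R v \<le> deg R a" "\<And>v. v \<in> R \<inter> B \<Longrightarrow> deg R v \<le> deg R b"
    "adj a b \<Longrightarrow> (\<forall>v \<in> R \<inter> A. deg R v = deg R a \<longrightarrow> adj v b) \<and>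
       (\<forall>v \<in> R \<inter> B. deg R v = deg R b \<longrightarrow> adj v a)"
proof -
  have "\<exists>v \<in> X. \<forall>u \<in> X. deg R u \<le> deg R v" if "finite X" "X \<noteq> {}" for X
  proof -
    have "Max (deg R ` X) \<in> deg R ` X" using that by (intro Max_in) auto
    then obtain v where "v \<in> X" "deg R v = Max (deg R ` X)" by auto
    then show ?thesis using that by (metis Max_ge finite_imageI imageI)
  qed
  moreover have "R \<inter> A \<noteq> {}" "R \<inter> B \<noteq> {}" using dense_sides[OF R] by auto
  ultimately obtain a b where ab: "a \<in> R \<inter> A" "b \<in> R \<inter> B"
    "\<And>v. v \<in> R \<inter> A \<Longrightarrow> deg R v \<le> deg R a" "\<And>v. v \<in> R \<inter> B \<Longrightarrow> deg R v \<le> deg R b"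
    using finite_A finite_B by (metis finite_Int)
  show thesis
  \<comment> \<open>Either some pair of maximum-degree vertices is non-adjacent and is chosen, or
    all such pairs are adjacent.\<close>
  proof (cases "\<exists>a' \<in> R \<inter> A. \<exists>b' \<in> R \<inter> B. deg R a' = deg R a \<and> deg R b' = deg R b \<and> \<not> adj a' b'")
    case True
    then obtain a' b' where "a' \<in> R \<inter> A" "b' \<in> R \<inter> B" "deg R a' = deg R a" "deg R b' = deg R b"
      "\<not> adj a' b'" by blast
    then show thesis using ab by (intro that[of a' b']) auto
  next
    case False
    then show thesis using ab adj_sym by (intro that[of a b]) blast+
  qed
qed

text \<open>The bounds \<open>p\<close> and \<open>q\<close> need not be attained, so that the
  induction hypothesis can be used with the bounds inherited from the previous set. Balance is
  measured on the deleted vertices.\<close>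

lemma dense_has_balanced_degen:
  assumes "R \<subseteq> A \<union> B" "dense R" "R \<noteq> {}"
    and "\<And>v. v \<in> R \<inter> A \<Longrightarrow> deg R v \<le> p" and "\<And>v. v \<in> R \<inter> B \<Longrightarrow> deg R v \<le> q"
  shows "\<exists>K \<subseteq> R. degen K \<and>
     \<bar>int (card (R \<inter> A - K)) - int (card (R \<inter> B - K))\<bar> \<le> 1 \<and>
     S R + w p + w q - 1 \<le> real (card K)"
  using assms
proof (induction "card R" arbitrary: R p q rule: less_induct)
  case less
  note R = less.prems(1-3)
  have fin: "finite R" using R finite_sub by blast
  obtain a b where a: "a \<in> R \<inter> A" and b: "b \<in> R \<inter> B"
    and leA: "\<And>v. v \<in> R \<inter> A \<Longrightarrow> deg R v \<le> deg R a"
    and leB: "\<And>v. v \<in> R \<inter> B \<Longrightarrow> deg R v \<le> deg R b"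
    and complete: "adj a b \<Longrightarrow> (\<forall>v \<in> R \<inter> A. deg R v = deg R a \<longrightarrow> adj v b) \<and>
       (\<forall>v \<in> R \<inter> B. deg R v = deg R b \<longrightarrow> adj v a)"
    using exists_max_pair[OF R] by metis
  define U where "U = R - {a, b}"
  have ab: "a \<noteq> b" using a b disjoint by auto
  have dab: "d < deg R a" "d < deg R b" using R a b by (auto simp: dense_def)
  have wle: "w p \<le> w (deg R a)" "w q \<le> w (deg R b)"
    using less.prems(4)[OF a] less.prems(5)[OF b] by (auto intro: w_antimono)
  have degU: "deg U v = deg R v - (if adj v a then 1 else 0) - (if adj v b then 1 else 0)" for v
  proof -
    have "U = R - {a} - {b}" by (auto simp: U_def)
    then show ?thesis using a b ab by (simp add: deg_delete)
  qed
  show ?case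
  proof (cases "core U = {}")
    case True
    have ex: "\<exists>K. (K = R - {a} \<or> K = R - {b} \<or> K = R - {a, b}) \<and> degen K \<and>
        S R + w (deg R a) + w (deg R b) - 1 \<le> real (card K)"
    \<comment> \<open>The vertex of larger degree goes first: its neighbours lie on the other side,
      so their degrees do not exceed its own.\<close>
    proof (cases "deg R b \<le> deg R a")
      case True
      have "deg R v \<le> deg R a" if "v \<in> R" "adj v a" for v
        using that leB[of v] True adj_sides[of v a] a disjoint by fastforce
      then show ?thesis
        using degen_of_vanishing_core[of R a b, OF R _ _ ab _ dab] a b \<open>core U = {}\<close>
        unfolding U_def by blast
    next
      case False
      have "deg R v \<le> deg R b" if "v \<in> R" "adj v b" for v
        using that leA[of v] False adj_sides[of v b] b disjoint by fastforce
      then show ?thesis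
        using degen_of_vanishing_core[of R b a, OF R _ _ ab[symmetric] _ dab] a b \<open>core U = {}\<close>
        unfolding U_def insert_commute[of b a] by blast
    qed
    then obtain K where K: "K = R - {a} \<or> K = R - {b} \<or> K = R - {a, b}" "degen K"
        "S R + w (deg R a) + w (deg R b) - 1 \<le> real (card K)" by blast
    have sides: "R \<inter> A - (R - {a}) = {a}" "R \<inter> B - (R - {a}) = {}"
      "R \<inter> A - (R - {b}) = {}" "R \<inter> B - (R - {b}) = {b}"
      "R \<inter> A - (R - {a, b}) = {a}" "R \<inter> B - (R - {a, b}) = {b}"
      using a b disjoint by auto
    have "\<bar>int (card (R \<inter> A - K)) - int (card (R \<inter> B - K))\<bar> \<le> 1"
      using K(1) sides by (elim disjE) (simp_all only: card.empty, simp_all)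
    moreover have "K \<subseteq> R" using K(1) by auto
    ultimately show ?thesis using K wle by (intro exI[of _ K]) auto
  next
    case False
    define C where "C = core U"
    have CU: "C \<subseteq> U" unfolding C_def by (rule core_subset)
    then have CR: "C \<subseteq> R" "a \<notin> C" "b \<notin> C" by (auto simp: U_def)
    then have CAB: "C \<subseteq> A \<union> B" using R by auto
    have smaller: "card C < card R"
      using CR a fin by (intro psubset_card_mono) auto
    have C: "dense C" "C \<noteq> {}" using False dense_core by (auto simp: C_def)
    have degC: "deg C v \<le> deg U v" for v using CU by (rule deg_mono)
    have SC: "S U \<le> real (card (U - C)) + S C"
      unfolding C_def using R by (intro S_le_core) (auto simp: U_def)
    have "\<exists>K \<subseteq> C. degen K \<and>
       \<bar>int (card (C \<inter> A - K)) - int (card (C \<inter> B - K))\<bar> \<le> 1 \<and>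
       S R + w (deg R a) + w (deg R b) - 1 - real (card (U - C)) \<le> real (card K)"
    proof (cases "adj a b")
      case nadj: False
      have "deg C v \<le> deg R a" if "v \<in> C \<inter> A" for v
        using leA[of v] deg_mono[of C R v] that CR by force
      moreover have "deg C v \<le> deg R b" if "v \<in> C \<inter> B" for v
        using leB[of v] deg_mono[of C R v] that CR by force
      ultimately obtain K where "K \<subseteq> C" "degen K"
        "\<bar>int (card (C \<inter> A - K)) - int (card (C \<inter> B - K))\<bar> \<le> 1"
        "S C + w (deg R a) + w (deg R b) - 1 \<le> real (card K)"
        using less.hyps[OF smaller CAB C] by blast
      moreover have "S R \<le> S U"
        unfolding U_def by (rule S_delete_nonadjacent[OF R(1,2) a b leA leB nadj])
      ultimately show ?thesis using SC by (intro exI[of _ K]) auto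
    next
      case adj: True
      \<comment> \<open>A vertex of maximum degree has lost its neighbour \<open>b\<close>; any
        other was below the maximum already.\<close>
      have "deg C v \<le> deg R a - 1" if "v \<in> C \<inter> A" for v
        using leA[of v] degC[of v] degU[of v] complete[OF adj] that CR by (cases "deg R v = deg R a") force+
      moreover have "deg C v \<le> deg R b - 1" if "v \<in> C \<inter> B" for v
        using leB[of v] degC[of v] degU[of v] complete[OF adj] that CR by (cases "deg R v = deg R b") force+
      ultimately obtain K where "K \<subseteq> C" "degen K"
        "\<bar>int (card (C \<inter> A - K)) - int (card (C \<inter> B - K))\<bar> \<le> 1"
        "S C + w (deg R a - 1) + w (deg R b - 1) - 1 \<le> real (card K)"
        using less.hyps[OF smaller CAB C] by blast
      moreover have "S R + w (deg R a) + w (deg R b) \<le> S U + w (deg R a - 1) + w (deg R b - 1)"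
        unfolding U_def by (rule S_delete_adjacent[OF R(1,2) a b leA leB adj])
      ultimately show ?thesis using SC by (intro exI[of _ K]) auto
    qed
    then obtain K where K: "K \<subseteq> C" "degen K"
      "\<bar>int (card (C \<inter> A - K)) - int (card (C \<inter> B - K))\<bar> \<le> 1"
      "S R + w (deg R a) + w (deg R b) - 1 - real (card (U - C)) \<le> real (card K)"
      by blast
    define L where "L = K \<union> (U - C)"
    have "degen L" unfolding L_def using K unfolding C_def by (intro degen_extend)
    moreover have "L \<subseteq> R" using K CR by (auto simp: L_def U_def)
    moreover have "card L = card K + card (U - C)"
      unfolding L_def using K CR fin
      by (intro card_Un_disjoint) (auto simp: U_def intro: finite_subset)
    \<comment> \<open>Each side gains exactly one deleted vertex, so the imbalance is
      unchanged.\<close>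
    moreover have "R \<inter> A - L = insert a (C \<inter> A - K)" "R \<inter> B - L = insert b (C \<inter> B - K)"
      using a b CR K disjoint by (auto simp: L_def U_def)
    then have "card (R \<inter> A - L) = Suc (card (C \<inter> A - K))"
      "card (R \<inter> B - L) = Suc (card (C \<inter> B - K))"
      using CR finite_A finite_B by auto
    ultimately show ?thesis using K wle by (intro exI[of _ L]) auto
  qed
qed

section \<open>Equal parts by rounding\<close>

lemma exists_balanced_degen:
  assumes eq: "card A = card B" and k: "2 * real k \<le> S (A \<union> B)"
  shows "\<exists>X Y. X \<subseteq> A \<and> Y \<subseteq> B \<and> card X = k \<and> card Y = k \<and> degen (X \<union> Y)"
proof -
  define V where "V = A \<union> B"
  define C where "C = core V"
  have V: "V \<subseteq> A \<union> B" by (simp add: V_def)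
  have CV: "C \<subseteq> V" unfolding C_def by (rule core_subset)
  have fin: "finite V" using V by (rule finite_sub)
  have "\<exists>K \<subseteq> C. degen K \<and> \<bar>int (card (C \<inter> A - K)) - int (card (C \<inter> B - K))\<bar> \<le> 1 \<and>
      S C - 1 < real (card K)"
  proof (cases "C = {}")
    case True
    then show ?thesis using degen_empty by (simp add: S_def)
  next
    case False
    \<comment> \<open>A crude degree bound is enough: positivity of \<open>w m\<close> makes the
      inequality strict, as the rounding below requires.\<close>
    define m where "m = card V"
    have "deg C v \<le> m" for v
      unfolding deg_def m_def using CV fin by (intro card_mono) (auto simp: nbs_def)
    then obtain K where "K \<subseteq> C" "degen K"
      "\<bar>int (card (C \<inter> A - K)) - int (card (C \<inter> B - K))\<bar> \<le> 1"
      "S C + w m + w m - 1 \<le> real (card K)"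
      using dense_has_balanced_degen[of C m m] False dense_core[of V] CV V
      unfolding C_def by blast
    then show ?thesis using w_pos[of m] by (intro exI[of _ K]) auto
  qed
  then obtain K where K: "K \<subseteq> C" "degen K"
    "\<bar>int (card (C \<inter> A - K)) - int (card (C \<inter> B - K))\<bar> \<le> 1" "S C - 1 < real (card K)"
    by blast
  define L where "L = K \<union> (V - C)"
  have L: "degen L" unfolding L_def using K unfolding C_def by (intro degen_extend)
  have LV: "L \<subseteq> A \<union> B" using K CV by (auto simp: L_def V_def)
  have "card L = card K + card (V - C)"
    unfolding L_def using K CV fin by (intro card_Un_disjoint) (auto intro: finite_subset)
  moreover have "S V \<le> real (card (V - C)) + S C" unfolding C_def by (rule S_le_core[OF V])
  ultimately have "2 * real k - 1 < real (card L)" using K(4) k by (simp add: V_def)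
  then have large: "2 * k \<le> card L" by linarith
  have "C \<inter> A - K = A - L \<inter> A" "C \<inter> B - K = B - L \<inter> B" using K CV by (auto simp: L_def V_def)
  then have "card (C \<inter> A - K) = card A - card (L \<inter> A)" "card (C \<inter> B - K) = card B - card (L \<inter> B)"
    using finite_A finite_B by (simp_all add: card_Diff_subset)
  moreover have "card (L \<inter> A) \<le> card A" "card (L \<inter> B) \<le> card B"
    using finite_A finite_B by (auto intro: card_mono)
  \<comment> \<open>As \<open>A\<close> and \<open>B\<close> have equal size, the imbalance of the
    deleted vertices is that of the kept ones.\<close>
  ultimately have "\<bar>int (card (L \<inter> A)) - int (card (L \<inter> B))\<bar> \<le> 1"
    using K(3) eq by linarith
  then have "k \<le> card (L \<inter> A)" "k \<le> card (L \<inter> B)"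
    using large card_sides[OF LV] by linarith+
  then obtain X Y where "X \<subseteq> L \<inter> A" "card X = k" "Y \<subseteq> L \<inter> B" "card Y = k"
    by (metis obtain_subset_with_card_n)
  moreover from this have "degen (X \<union> Y)" by (intro degen_subset[OF L]) auto
  ultimately show ?thesis by blast
qed

end

section \<open>Transfer to digraphs\<close>

text \<open>Without parallel arcs, \<open>head\<close> is injective on the arcs leaving
  \<open>v\<close>. The subgraph need not be induced, hence only an inequality.\<close>

lemma (in graph) degree_subgraph_le:
  assumes "subgraph H G"
  shows "degree H v \<le> card {u \<in> verts H. v \<rightarrow>\<^bsub>G\<^esub> u}"
proof -
  interpret H: wf_digraph H using assms by (auto simp: subgraph_def)
  have arcs: "arcs H \<subseteq> arcs G" and ends: "tail H = tail G" "head H = head G"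
    and verts: "verts H \<subseteq> verts G"
    using assms by (auto simp: subgraph_def compatible_def)
  have "inj_on (head G) (out_arcs H v)"
    using arcs ends by (auto intro!: inj_onI no_multi_arcs simp: arc_to_ends_def)
  moreover have "head G ` out_arcs H v \<subseteq> {u \<in> verts H. v \<rightarrow>\<^bsub>G\<^esub> u}"
    using arcs ends H.head_in_verts by (force simp: arcs_ends_conv)
  moreover have "finite {u \<in> verts H. v \<rightarrow>\<^bsub>G\<^esub> u}"
    using finite_subset[OF verts finite_verts] by simp
  ultimately show ?thesis unfolding out_degree_def by (metis card_inj_on_le)
qed

theorem theorem6:
  fixes G :: "('a, 'b) pre_digraph" and A B :: "'a set" and n d :: nat
  assumes "bipartite_graph n G A B" and "n \<ge> 1"
  shows "int (beta d G A B) \<ge>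
    \<lfloor>(1 / 2 :: real) * (\<Sum>v \<in> verts G. min 1 ((real d + 1) / (real (degree G v) + 1)))\<rfloor>"
proof -
  define s where "s = (\<Sum>v \<in> verts G. min 1 ((real d + 1) / (real (degree G v) + 1)))"
  define k where "k = nat \<lfloor>(1 / 2) * s\<rfloor>"
  interpret graph G using assms by (simp add: bipartite_graph_def)
  have V: "verts G = A \<union> B" "A \<inter> B = {}" "card A = n" "card B = n"
    and bip: "\<And>e. e \<in> arcs G \<Longrightarrow>
      (tail G e \<in> A \<and> head G e \<in> B) \<or> (tail G e \<in> B \<and> head G e \<in> A)"
    using assms by (auto simp: bipartite_graph_def)
  have fin: "finite A" "finite B" using finite_verts unfolding V by auto
  interpret bipartite_adjacency A B "\<lambda>u v. u \<rightarrow>\<^bsub>G\<^esub> v" d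
  proof
    show "v \<rightarrow>\<^bsub>G\<^esub> u" if "u \<rightarrow>\<^bsub>G\<^esub> v" for u v
      using that sym_arcs by (rule arcs_ends_symmetric[rotated])
    show "(u \<in> A \<and> v \<in> B) \<or> (u \<in> B \<and> v \<in> A)" if "u \<rightarrow>\<^bsub>G\<^esub> v" for u v
      using that bip by (auto simp: arcs_ends_conv)
  qed (use fin V in auto)
  have deg_G: "deg (verts G) v \<ge> degree G v" for v
    using degree_subgraph_le[of G v] by (simp add: deg_def nbs_def subgraph_refl)
  have deg_le: "deg (verts G) v \<le> degree G v" for v
  proof -
    have "nbs (verts G) v \<subseteq> head G ` out_arcs G v" unfolding nbs_def by (auto simp: arcs_ends_conv)
    then show ?thesis unfolding deg_def out_degree_def
      by (meson card_image_le card_mono finite_imageI finite_out_arcs order_trans)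
  qed
  have "s = S (A \<union> B)"
    unfolding s_def S_def w_def V(1)[symmetric] using deg_G deg_le by (metis order_antisym)
  \<comment> \<open>Nonnegativity ensures that \<open>nat\<close> does not truncate the
    floor.\<close>
  moreover have "0 \<le> s" unfolding s_def by (intro sum_nonneg) auto
  then have k: "int k = \<lfloor>(1 / 2) * s\<rfloor>" by (simp add: k_def)
  then have "2 * real k \<le> s" by linarith
  ultimately obtain X Y where XY: "X \<subseteq> A" "Y \<subseteq> B" "card X = k" "card Y = k" "degen (X \<union> Y)"
    using exists_balanced_degen[of k] V by auto
  have "degenerate d (G \<restriction> (X \<union> Y))"
    unfolding degenerate_def
  proof (intro allI impI)
    fix H assume H: "graph H \<and> subgraph H (G \<restriction> (X \<union> Y)) \<and> verts H \<noteq> {}"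
    then have sub: "verts H \<subseteq> X \<union> Y" by (auto simp: subgraph_def)
    have "subgraph H G"
      using H XY(1,2) V(1) subgraph_trans[of H _ G] induced_imp_subgraph induced_induce
      by (metis Un_mono)
    then have le: "degree H v \<le> deg (verts H) v" for v
      using degree_subgraph_le by (simp add: deg_def nbs_def)
    \<comment> \<open>\<open>degen\<close> speaks about the subgraph induced on
      \<open>verts H\<close>; a vertex of degree at most \<open>d\<close> there has at most that
      degree in \<open>H\<close>.\<close>
    from H sub XY(5) have "\<not> dense (verts H)" by (auto simp: degen_def)
    then show "\<exists>v\<in>verts H. degree H v \<le> d"
      using le by (force simp: dense_def not_less intro: order_trans)
  qed
  moreover have "finite {k. \<exists>X Y. X \<subseteq> A \<and> Y \<subseteq> B \<and> card X = k \<and> card Y = k \<and>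
      degenerate d (G \<restriction> (X \<union> Y))}"
    by (rule finite_subset[of _ "{..card A}"]) (auto intro: card_mono fin)
  ultimately have "k \<le> beta d G A B"
    unfolding beta_def using XY by (intro Max_ge) auto
  then show ?thesis using k unfolding s_def by linarith
qed

end
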